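(* Assume (H0) and (H1). For any initial condition in $\mathcal Z_1$, the optimal trajectory stays in $\mathcal Z_1$ until reaching the target $\mathcal T$, and the constant control $u=1$ is optimal until reaching the target.
   Context: Setting. Let $M>0$ and $\underline S_1,\underline S_2>0$ with $\underline S_1+\underline S_2<M$. The functions $f,\mu:\mathbb R_+\to\mathbb R_+$ are continuously differentiable and satisfy: (H0) $f$ is increasing and $f(0)=0$; (H1) $\mu$ is non-negative and vanishes only at $0$, and either there is $S_2^\star>0$ such that $\mu$ is increasing on $[0,S_2^\star)$ and decreasing on $(S_2^\star,+\infty)$, or $\mu$ is increasing and one puts $S_2^\star=+\infty$. Consider $$\dot S_1=-u f(S_1),\qquad \dot S_2=u f(S_1)-\mu(S_2)(M-S_1-S_2)$$ on the invariant domain $\mathcal D=\{(S_1,S_2)\in\mathbb R_+\times\mathbb R_+:0<S_1+S_2<M\}$, with measurable controls $u:[0,\infty)\to[0,1]$. The target is $\mathcal T=[0,\underline S_1]\times[0,\underline S_2]$. The problem is to reach $\mathcal T$ in minimal time $t_f$ from a given point of $\mathcal D\setminus\mathcal T$; a trajectory (or control) is optimal if it achieves this minimal time. The set $\mathcal Z_1$ is $\{(S_1,S_2)\in\mathcal D\setminus\mathcal T: S_1\in(\underline S_1,\underline\sigma_1],\ S_2\le\sigma_2(S_1)\}$, where $\sigma_2$ solves $\frac{d\sigma_2}{d\sigma_1}=\frac{\mu(\sigma_2)(M-\sigma_1-\sigma_2)}{f(\sigma_1)}-1$, $\sigma_2(\underline S_1)=\underline S_2$, on $[\underline S_1,\underline\sigma_1]$,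 and $\underline\sigma_1$ is the smallest $\sigma_1>\underline S_1$ with $\sigma_2(\sigma_1)=0$. *)

theory Defs
  imports "HOL-Analysis.Analysis"
begin

section \<open>Kinetics\<close>

text \<open>Functions on the nonnegative half-line are represented by total functions on
  \<^typ>\<open>real\<close>; all hypotheses only concern arguments \<open>x \<ge> 0\<close>, with a one-sided derivative
  at \<open>0\<close>. Monotonicity is understood in the strict sense: without it \<open>f\<close> could vanish at
  positive arguments and the equation for \<open>\<sigma>\<^sub>2\<close> below, which divides by \<open>f\<close>, would make no
  sense.\<close>

definition C1_nonneg :: "(real \<Rightarrow> real) \<Rightarrow> bool" where
  "C1_nonneg g \<longleftrightarrow>
     (\<forall>x\<ge>0. 0 \<le> g x) \<and>
     (\<exists>g'. (\<forall>x\<ge>0. (g has_real_derivative g' x) (at x within {0..})) \<and>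
           continuous_on {0..} g')"

definition H0 :: "(real \<Rightarrow> real) \<Rightarrow> bool" where
  "H0 f \<longleftrightarrow> strict_mono_on {0..} f \<and> f 0 = 0"

text \<open>The second disjunct is the case \<open>S\<^sub>2\<^sup>\<star> = \<infinity>\<close>.\<close>

definition H1 :: "(real \<Rightarrow> real) \<Rightarrow> bool" where
  "H1 \<mu> \<longleftrightarrow>
     (\<forall>x\<ge>0. 0 \<le> \<mu> x) \<and> (\<forall>x\<ge>0. \<mu> x = 0 \<longleftrightarrow> x = 0) \<and>
     ((\<exists>S2star>0. strict_mono_on {0..<S2star} \<mu> \<and> strict_antimono_on {S2star<..} \<mu>) \<or>
      strict_mono_on {0..} \<mu>)"

section \<open>The controlled system and the minimal time problem\<close>

definition state_domain :: "real \<Rightarrow> (real \<times> real) set" where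
  "state_domain M = {(s1, s2). 0 \<le> s1 \<and> 0 \<le> s2 \<and> 0 < s1 + s2 \<and> s1 + s2 < M}"

definition target :: "real \<Rightarrow> real \<Rightarrow> (real \<times> real) set" where
  "target b1 b2 = {0..b1} \<times> {0..b2}"

definition admissible_control :: "(real \<Rightarrow> real) \<Rightarrow> bool" where
  "admissible_control u \<longleftrightarrow>
     u \<in> borel_measurable (lebesgue_on {0..}) \<and> (\<forall>t\<ge>0. 0 \<le> u t \<and> u t \<le> 1)"

text \<open>Since \<open>u\<close> is merely measurable, solutions are meant in the sense of Caratheodory, i.e.
  they satisfy the integrated equations. The integral is the Henstock-Kurzweil one; it
  coincides here with the Lebesgue integral, because an indefinite integral is continuous, so
  that both integrands are bounded and measurable on \<open>{0..t}\<close>.\<close>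

definition trajectory ::
    "(real \<Rightarrow> real) \<Rightarrow> (real \<Rightarrow> real) \<Rightarrow> real \<Rightarrow> (real \<Rightarrow> real) \<Rightarrow>
     real \<times> real \<Rightarrow> (real \<Rightarrow> real \<times> real) \<Rightarrow> bool" where
  "trajectory f \<mu> M u x0 S \<longleftrightarrow>
     S 0 = x0 \<and> (\<forall>t\<ge>0. S t \<in> state_domain M) \<and>
     (\<forall>t\<ge>0. ((\<lambda>s. - u s * f (fst (S s))) has_integral (fst (S t) - fst x0)) {0..t}) \<and>
     (\<forall>t\<ge>0. ((\<lambda>s. u s * f (fst (S s)) - \<mu> (snd (S s)) * (M - fst (S s) - snd (S s)))
              has_integral (snd (S t) - snd x0)) {0..t})"

text \<open>\<open>S\<close>, driven by \<open>u\<close>, is in the target at time \<open>tf\<close>, and no admissible trajectory from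
  \<open>x0\<close> is in the target earlier. Comparing \<open>S\<close> with itself shows that \<open>tf\<close> is the first time
  at which \<open>S\<close> hits the target.\<close>

definition optimal_trajectory ::
    "(real \<Rightarrow> real) \<Rightarrow> (real \<Rightarrow> real) \<Rightarrow> real \<Rightarrow> real \<Rightarrow> real \<Rightarrow> real \<times> real \<Rightarrow>
     (real \<Rightarrow> real) \<Rightarrow> (real \<Rightarrow> real \<times> real) \<Rightarrow> real \<Rightarrow> bool" where
  "optimal_trajectory f \<mu> M b1 b2 x0 u S tf \<longleftrightarrow>
     admissible_control u \<and> trajectory f \<mu> M u x0 S \<and> 0 \<le> tf \<and> S tf \<in> target b1 b2 \<and>
     (\<forall>v R t. admissible_control v \<and> trajectory f \<mu> M v x0 R \<and> 0 \<le> t \<and> R t \<in> target b1 b2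
        \<longrightarrow> tf \<le> t)"

definition optimal_control ::
    "(real \<Rightarrow> real) \<Rightarrow> (real \<Rightarrow> real) \<Rightarrow> real \<Rightarrow> real \<Rightarrow> real \<Rightarrow> real \<times> real \<Rightarrow>
     (real \<Rightarrow> real) \<Rightarrow> bool" where
  "optimal_control f \<mu> M b1 b2 x0 u \<longleftrightarrow>
     (\<exists>S. trajectory f \<mu> M u x0 S) \<and>
     (\<forall>S. trajectory f \<mu> M u x0 S \<longrightarrow> (\<exists>tf. optimal_trajectory f \<mu> M b1 b2 x0 u S tf))"

section \<open>The set bounded by the curve through the corner of the target\<close>

text \<open>\<open>c\<close> is the smallest zero of \<open>\<sigma>\<^sub>2\<close> to the right of \<open>b1\<close>. As \<open>\<sigma>\<^sub>2 b1 = b2 > 0\<close> in the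
  intended use, \<open>\<sigma>\<^sub>2\<close> is nonnegative on \<open>{b1..c}\<close>, so \<open>\<mu>\<close> is only evaluated at nonnegative
  arguments.\<close>

definition boundary_curve ::
    "(real \<Rightarrow> real) \<Rightarrow> (real \<Rightarrow> real) \<Rightarrow> real \<Rightarrow> real \<Rightarrow> real \<Rightarrow> (real \<Rightarrow> real) \<Rightarrow> real \<Rightarrow> bool" where
  "boundary_curve f \<mu> M b1 b2 \<sigma>\<^sub>2 c \<longleftrightarrow>
     \<sigma>\<^sub>2 b1 = b2 \<and>
     (\<forall>s\<in>{b1..c}. (\<sigma>\<^sub>2 has_real_derivative \<mu> (\<sigma>\<^sub>2 s) * (M - s - \<sigma>\<^sub>2 s) / f s - 1)
                    (at s within {b1..c})) \<and>
     b1 < c \<and> \<sigma>\<^sub>2 c = 0 \<and> (\<forall>s. b1 < s \<and> s < c \<longrightarrow> \<sigma>\<^sub>2 s \<noteq> 0)"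

definition Z1 :: "real \<Rightarrow> real \<Rightarrow> real \<Rightarrow> (real \<Rightarrow> real) \<Rightarrow> real \<Rightarrow> (real \<times> real) set" where
  "Z1 M b1 b2 \<sigma>\<^sub>2 c =
     {(s1, s2) \<in> state_domain M - target b1 b2. b1 < s1 \<and> s1 \<le> c \<and> s2 \<le> \<sigma>\<^sub>2 s1}"

end

theory Submission
  imports Defs
begin

text \<open>\<open>S\<^sub>1\<close> decreases at most as fast as under \<open>u = 1\<close>, and it must drop to the level \<open>b1\<close>. The boundary
  curve is itself a trajectory for \<open>u = 1\<close> ending in the corner of the target, so from a point below
  it the control \<open>u = 1\<close> keeps \<open>S\<^sub>2\<close> below it and hits the target exactly when \<open>S\<^sub>1 = b1\<close>: no control
  is faster. Conversely, a control that is equally fast has the same \<open>S\<^sub>1\<close>; as \<open>S\<^sub>1 + S\<^sub>2\<close> solves an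
  equation not containing \<open>u\<close>, its \<open>S\<^sub>2\<close> stays below the curve as well.\<close>

section \<open>Differential inequalities and global solutions\<close>

text \<open>The times with \<open>y t >= 0\<close> form a compact set; its last point
  \<open>s\<close> must be a zero, since a positive value there would force another crossing later.
  Comparison arguments restart at \<open>s\<close>, because the sign of \<open>y\<close> is fixed
  afterwards.\<close>

lemma last_zero_before_negative:
  fixes y :: "real \<Rightarrow> real"
  assumes "a \<le> b" and cont: "continuous_on {a..b} y" and "0 \<le> y a" and "y b < 0"
  obtains s where "a \<le> s" "s < b" "y s = 0" "\<And>t. s < t \<Longrightarrow> t \<le> b \<Longrightarrow> y t < 0"
proof -
  define A where "A = {a..b} \<inter> y -` {0..}"
  have "compact A"
    using continuous_closed_preimage[OF cont closed_atLeastAtMost closed_atLeast, of 0]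
    by (auto simp: A_def compact_eq_bounded_closed intro: bounded_subset[OF bounded_closed_interval])
  moreover have "a \<in> A" using assms by (auto simp: A_def)
  ultimately obtain s where s: "s \<in> A" and max: "\<forall>t\<in>A. t \<le> s"
    using compact_attains_sup by blast
  have "s < b" using s \<open>y b < 0\<close> by (auto simp: A_def less_le)
  have neg: "y t < 0" if "s < t" "t \<le> b" for t
    using bspec[OF max, of t] that s by (auto simp: A_def not_le[symmetric])
  have "y s = 0"
  proof (rule ccontr)
    assume "y s \<noteq> 0"
    with s have "0 < y s" by (auto simp: A_def)
    moreover have "continuous_on {s..b} y"
      by (rule continuous_on_subset[OF cont]) (use s in \<open>auto simp: A_def\<close>)
    ultimately obtain t where "s \<le> t" "t \<le> b" "y t = 0"
      using IVT2'[of y b 0 s] \<open>y b < 0\<close> \<open>s < b\<close> by force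
    with neg[of t] \<open>0 < y s\<close> show False by (cases "t = s") auto
  qed
  with that s \<open>s < b\<close> neg show ?thesis by (auto simp: A_def)
qed

text \<open>A Gronwall argument. After a last zero, \<open>y\<close> is negative and
  \<open>\<bar>y\<bar> = - y\<close>, so the bound reads \<open>y' - L * y >= 0\<close>. Then
  \<open>y t * exp (- L * t)\<close> is nondecreasing from 0 and cannot become negative.\<close>

lemma nonneg_of_linear_lower_bound:
  fixes y y' :: "real \<Rightarrow> real"
  assumes "0 \<le> T" and cont: "continuous_on {0..T} y"
    and der: "\<And>t. 0 < t \<Longrightarrow> t < T \<Longrightarrow> (y has_real_derivative y' t) (at t)"
    and ge: "\<And>t. 0 < t \<Longrightarrow> t < T \<Longrightarrow> - L * \<bar>y t\<bar> \<le> y' t"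
    and "0 \<le> y 0"
  shows "0 \<le> y T"
proof (rule ccontr)
  assume "\<not> 0 \<le> y T"
  then obtain s where s: "0 \<le> s" "s < T" "y s = 0" and neg: "\<And>t. s < t \<Longrightarrow> t \<le> T \<Longrightarrow> y t < 0"
    using last_zero_before_negative[OF \<open>0 \<le> T\<close> cont \<open>0 \<le> y 0\<close>] by (metis not_le)
  have "y s * exp (- L * s) \<le> y T * exp (- L * T)"
  proof (rule DERIV_nonneg_imp_increasing_open[where f = "\<lambda>t. y t * exp (- L * t)"])
    show "continuous_on {s..T} (\<lambda>t. y t * exp (- L * t))"
      by (intro continuous_intros continuous_on_subset[OF cont]) (use s in auto)
    fix t assume t: "s < t" "t < T"
    have "((\<lambda>t. y t * exp (- L * t)) has_real_derivative (y' t - L * y t) * exp (- L * t)) (at t)"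
      using t s by (auto intro!: derivative_eq_intros der simp: algebra_simps)
    moreover have "0 \<le> y' t - L * y t" using ge[of t] neg[of t] t s by auto
    ultimately show "\<exists>d. ((\<lambda>t. y t * exp (- L * t)) has_real_derivative d) (at t) \<and> 0 \<le> d"
      by (meson exp_ge_zero mult_nonneg_nonneg)
  qed (use s in auto)
  with s neg[of T] show False by (simp add: zero_le_mult_iff)
qed

text \<open>Once \<open>y\<close> is known to be nonnegative, the bound becomes
  \<open>y' + L * y >= 0\<close>, so \<open>y\<close> decays at most exponentially and a positive
  start survives.\<close>

lemma pos_of_linear_lower_bound:
  fixes y y' :: "real \<Rightarrow> real"
  assumes "0 \<le> T" and cont: "continuous_on {0..T} y"
    and der: "\<And>t. 0 < t \<Longrightarrow> t < T \<Longrightarrow> (y has_real_derivative y' t) (at t)"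
    and ge: "\<And>t. 0 < t \<Longrightarrow> t < T \<Longrightarrow> - L * \<bar>y t\<bar> \<le> y' t"
    and "0 < y 0"
  shows "0 < y T"
proof -
  have nonneg: "0 \<le> y t" if "0 \<le> t" "t < T" for t
    by (rule nonneg_of_linear_lower_bound[where L = L and y' = y'])
      (use that assms in \<open>auto intro: continuous_on_subset[OF cont]\<close>)
  have "y 0 * exp (L * 0) \<le> y T * exp (L * T)"
  proof (rule DERIV_nonneg_imp_increasing_open[where f = "\<lambda>t. y t * exp (L * t)"])
    show "continuous_on {0..T} (\<lambda>t. y t * exp (L * t))"
      by (intro continuous_intros cont)
    fix t assume t: "0 < t" "t < T"
    have "((\<lambda>t. y t * exp (L * t)) has_real_derivative (y' t + L * y t) * exp (L * t)) (at t)"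
      using t by (auto intro!: derivative_eq_intros der simp: algebra_simps)
    moreover have "0 \<le> y' t + L * y t" using ge[of t] nonneg[of t] t by auto
    ultimately show "\<exists>d. ((\<lambda>t. y t * exp (L * t)) has_real_derivative d) (at t) \<and> 0 \<le> d"
      by (meson exp_ge_zero mult_nonneg_nonneg)
  qed (use assms in auto)
  then have "0 < y T * exp (L * T)" using \<open>0 < y 0\<close> by simp
  then show ?thesis by (simp add: zero_less_mult_iff)
qed

section \<open>Global existence for Lipschitz equations\<close>

lemma at_within_Icc_Ici: "0 \<le> (t::real) \<Longrightarrow> at t within {0..t + 1} = at t within {0..}"
  by (rule at_within_nhd[of _ "{..<t+1}"]) auto

text \<open>Integrating \<open>exp (K * s)\<close> gains a factor \<open>1 / K\<close>. This is the
  source of the contraction constant \<open>L / K\<close> below.\<close>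

lemma norm_integral_le_exp:
  fixes g :: "real \<Rightarrow> 'a::banach"
  assumes "0 < K" "0 \<le> T" "continuous_on {0..T} g"
    and "\<And>s. 0 \<le> s \<Longrightarrow> s \<le> T \<Longrightarrow> norm (g s) \<le> A * exp (K * s)"
  shows "norm (integral {0..T} g) \<le> A * (exp (K * T) - 1) / K"
proof -
  have "((\<lambda>s. A * exp (K * s)) has_integral A * exp (K * T) / K - A * exp (K * 0) / K) {0..T}"
    using assms(1,2) by (intro fundamental_theorem_of_calculus)
      (auto intro!: derivative_eq_intros
        simp flip: has_real_derivative_iff_has_vector_derivative)
  then have "((\<lambda>s. A * exp (K * s)) has_integral A * (exp (K * T) - 1) / K) {0..T}"
    by (simp add: right_diff_distrib diff_divide_distrib)
  with integral_norm_bound_integral[of g "{0..T}" "\<lambda>s. A * exp (K * s)"] assms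
  show ?thesis by (auto simp: has_integral_iff intro: integrable_continuous_real)
qed

text \<open>The Picard operator is a contraction on all of \<open>[0, \<infinity>)\<close> at once when solutions are measured in
  the norm weighted by \<open>exp (- K t)\<close> with \<open>K > L\<close>; \<open>z\<close> below is the weighted solution.\<close>

lemma lipschitz_ode_global_solution:
  fixes F :: "'a::banach \<Rightarrow> 'a"
  assumes lip: "L-lipschitz_on UNIV F"
  obtains y where "y 0 = x0" "\<And>t. 0 \<le> t \<Longrightarrow> (y has_vector_derivative F (y t)) (at t within {0..})"
proof -
  have L: "0 \<le> L" using lip by (rule lipschitz_on_nonneg)
  define K where "K = L + 1"
  have K: "0 < K" "L < K" using L by (auto simp: K_def)
  have contF: "continuous_on UNIV F" using lip by (rule lipschitz_on_continuous_on)
  \<comment> \<open>Since \<open>z\<close> stands for \<open>exp (- K * s)\<close> times the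
    solution, the weight is undone before \<open>F\<close> is applied.\<close>
  define I where "I z t = integral {0..t} (\<lambda>s. F (exp (K * s) *\<^sub>R apply_bcontfun z s))" for z t
  \<comment> \<open>Bounded continuous functions are taken on the whole real line, so
    \<open>P z\<close> is extended to negative times by its value at 0.\<close>
  define P where "P z t = exp (- K * max 0 t) *\<^sub>R (x0 + I z (max 0 t))" for z t
  have cont: "continuous_on S (\<lambda>s. F (exp (K * s) *\<^sub>R apply_bcontfun z s))" for z S
    by (intro continuous_on_compose2[OF contF] continuous_intros) auto
  have norm_F: "norm (F v) \<le> norm (F 0) + L * norm v" for v
    using lipschitz_onD[OF lip, of v 0] norm_triangle_ineq2[of "F v" "F 0"] by (simp add: dist_norm)
  have I_bound: "norm (I z T) \<le> (norm (F 0) + L * norm z) * (exp (K * T) - 1) / K" if "0 \<le> T" for z T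
    unfolding I_def
  proof (rule norm_integral_le_exp[OF K(1) that cont])
    fix s assume s: "0 \<le> s" "s \<le> T"
    have "norm (F 0) + L * norm (exp (K * s) *\<^sub>R apply_bcontfun z s)
        \<le> norm (F 0) * exp (K * s) + L * (exp (K * s) * norm z)"
      using s K L norm_bounded[of z s]
      by (auto intro!: add_mono mult_left_mono simp: mult_le_cancel_left1)
    with norm_F[of "exp (K * s) *\<^sub>R apply_bcontfun z s"]
    show "norm (F (exp (K * s) *\<^sub>R apply_bcontfun z s)) \<le> (norm (F 0) + L * norm z) * exp (K * s)"
      by (simp add: algebra_simps)
  qed
  have I_diff: "norm (I z T - I w T) \<le> (L * dist z w) * (exp (K * T) - 1) / K" if "0 \<le> T" for z w T
  proof -
    have "I z T - I w T = integral {0..T}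
        (\<lambda>s. F (exp (K * s) *\<^sub>R apply_bcontfun z s) - F (exp (K * s) *\<^sub>R apply_bcontfun w s))"
      unfolding I_def by (intro integral_diff[symmetric] integrable_continuous_real cont)
    moreover have "norm (F (exp (K * s) *\<^sub>R apply_bcontfun z s) - F (exp (K * s) *\<^sub>R apply_bcontfun w s))
        \<le> (L * dist z w) * exp (K * s)" for s
    proof -
      have "norm (F (exp (K * s) *\<^sub>R apply_bcontfun z s) - F (exp (K * s) *\<^sub>R apply_bcontfun w s))
        \<le> L * (exp (K * s) * dist (apply_bcontfun z s) (apply_bcontfun w s))"
        using lipschitz_onD[OF lip, of "exp (K * s) *\<^sub>R apply_bcontfun z s" "exp (K * s) *\<^sub>R apply_bcontfun w s"]
        by (simp add: dist_norm flip: scaleR_diff_right)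
      also have "\<dots> \<le> L * (exp (K * s) * dist z w)"
        by (intro mult_left_mono dist_bounded L) auto
      finally show ?thesis by (simp add: mult_ac)
    qed
    ultimately show ?thesis
      using norm_integral_le_exp[OF K(1) that,
        of "\<lambda>s. F (exp (K * s) *\<^sub>R apply_bcontfun z s) - F (exp (K * s) *\<^sub>R apply_bcontfun w s)"
          "L * dist z w"]
        cont by (simp add: continuous_on_diff)
  qed
  \<comment> \<open>The weight absorbs the exponential growth of the integral, which leaves bounds
    uniform in time.\<close>
  have weight: "exp (- K * T) * (A * (exp (K * T) - 1) / K) \<le> A / K" if "0 \<le> A" for A T
  proof -
    have "exp (- K * T) * (A * (exp (K * T) - 1) / K) = A / K * (1 - exp (- K * T))"
      by (simp add: field_simps exp_minus)
    also have "\<dots> \<le> A / K * 1" using that K by (intro mult_left_mono) auto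
    finally show ?thesis by simp
  qed
  have I_deriv: "(I z has_vector_derivative F (exp (K * t) *\<^sub>R apply_bcontfun z t)) (at t within {0..})"
    if "0 \<le> t" for z t
  proof -
    have "(I z has_vector_derivative F (exp (K * t) *\<^sub>R apply_bcontfun z t)) (at t within {0..t + 1})"
      unfolding I_def[abs_def] by (rule integral_has_vector_derivative[OF cont]) (use that in auto)
    then show ?thesis by (simp add: at_within_Icc_Ici that)
  qed
  have P_bcontfun: "P z \<in> bcontfun" for z
  proof (rule bcontfun_normI)
    have "continuous_on {0..} (I z)"
      by (meson I_deriv atLeast_iff continuous_on_eq_continuous_within has_vector_derivative_continuous)
    then show "continuous_on UNIV (P z)"
      unfolding P_def[abs_def]
      by (intro continuous_intros continuous_on_compose2[of "{0..}" "I z" UNIV "max 0"]) auto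
    fix t :: real
    let ?T = "max 0 t"
    have "norm (P z t) \<le> exp (- K * ?T) * (norm x0 + norm (I z ?T))"
      unfolding P_def by (simp add: norm_triangle_ineq)
    also have "\<dots> \<le> norm x0 + exp (- K * ?T) * ((norm (F 0) + L * norm z) * (exp (K * ?T) - 1) / K)"
      unfolding distrib_left using K
      by (intro add_mono mult_left_mono I_bound) (auto simp: mult_le_cancel_right2)
    also have "\<dots> \<le> norm x0 + (norm (F 0) + L * norm z) / K"
      using weight[of "norm (F 0) + L * norm z" ?T] L by simp
    finally show "norm (P z t) \<le> norm x0 + (norm (F 0) + L * norm z) / K" .
  qed
  have "\<exists>!z. Bcontfun (P z) = z"
  proof (rule banach_fix_type[of "L / K"], safe)
    fix z w :: "real \<Rightarrow>\<^sub>C 'a"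
    show "dist (Bcontfun (P z)) (Bcontfun (P w)) \<le> L / K * dist z w"
    proof (rule dist_bound)
      fix t :: real
      let ?T = "max 0 t"
      have "dist (P z t) (P w t) = exp (- K * ?T) * norm (I z ?T - I w ?T)"
        unfolding P_def dist_norm by (simp flip: scaleR_diff_right)
      also have "\<dots> \<le> exp (- K * ?T) * ((L * dist z w) * (exp (K * ?T) - 1) / K)"
        by (intro mult_left_mono I_diff) auto
      also have "\<dots> \<le> L * dist z w / K" using L by (intro weight) auto
      finally show "dist (apply_bcontfun (Bcontfun (P z)) t) (apply_bcontfun (Bcontfun (P w)) t) \<le> L / K * dist z w"
        by (simp add: Bcontfun_inverse[OF P_bcontfun])
    qed
  qed (use L K in auto)
  then obtain z where "Bcontfun (P z) = z" by blast
  then have z: "apply_bcontfun z t = P z t" for t by (metis Bcontfun_inverse[OF P_bcontfun])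
  define y where "y t = x0 + I z t" for t
  have y: "exp (K * t) *\<^sub>R apply_bcontfun z t = y t" if "0 \<le> t" for t
    using that by (simp add: z P_def y_def max_absorb2 flip: exp_add)
  show ?thesis
  proof (rule that)
    show "y 0 = x0" by (simp add: y_def I_def)
    fix t :: real assume t: "0 \<le> t"
    show "(y has_vector_derivative F (y t)) (at t within {0..})"
      unfolding y_def[abs_def]
      using has_vector_derivative_add[OF has_vector_derivative_const I_deriv[OF t, of z]] y[OF t]
      by (simp add: y_def)
  qed
qed

text \<open>A continuous derivative is bounded on the compact interval only, hence the constant
  depends on \<open>B\<close>; the mean value inequality does the rest.\<close>

lemma C1_nonneg_lipschitz:
  assumes "C1_nonneg g"
  obtains L where "0 \<le> L" "\<And>x y. x \<in> {0..B} \<Longrightarrow> y \<in> {0..B} \<Longrightarrow> \<bar>g x - g y\<bar> \<le> L * \<bar>x - y\<bar>"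
proof -
  obtain g' where der: "\<And>x. 0 \<le> x \<Longrightarrow> (g has_real_derivative g' x) (at x within {0..})"
    and "continuous_on {0..} g'"
    using assms by (auto simp: C1_nonneg_def)
  then have "compact (g' ` {0..B})"
    by (intro compact_continuous_image) (auto intro: continuous_on_subset)
  then have "bounded (g' ` {0..B})" by (rule compact_imp_bounded)
  then obtain L where L: "0 < L" "\<forall>x\<in>{0..B}. \<bar>g' x\<bar> \<le> L"
    unfolding bounded_pos by auto
  have "norm (g x - g y) \<le> L * norm (x - y)" if "x \<in> {0..B}" "y \<in> {0..B}" for x y
    by (rule field_differentiable_bound[of "{0..B}" g g'])
      (use L that in \<open>auto intro: DERIV_subset[OF der]\<close>)
  with that[of L] L show ?thesis by auto
qed

lemma C1_nonneg_continuous: "C1_nonneg g \<Longrightarrow> continuous_on {0..} g"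
  by (auto simp: C1_nonneg_def intro: DERIV_continuous_on)

section \<open>From integrated equations to continuity and derivatives\<close>

lemma has_integral_increment:
  fixes g y :: "real \<Rightarrow> real"
  assumes int: "\<And>t. 0 \<le> t \<Longrightarrow> (g has_integral (y t - a)) {0..t}" and "0 \<le> s" "s \<le> t"
  shows "(g has_integral (y t - y s)) {s..t}"
proof -
  have int_t: "g integrable_on {0..t}" using int[of t] assms by (meson has_integral_integrable order_trans)
  from int_t have "g integrable_on {s..t}"
    by (rule integrable_on_subinterval) (use assms in auto)
  moreover have "integral {0..s} g + integral {s..t} g = integral {0..t} g"
    using assms(2,3) int_t
    by (intro Henstock_Kurzweil_Integration.integral_combine)
  ultimately show ?thesis
    using integral_unique[OF int[of s]] integral_unique[OF int[of t]] assms
    by (simp add: has_integral_iff)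
qed

lemma continuous_of_has_integral:
  fixes g y :: "real \<Rightarrow> real"
  assumes int: "\<And>t. 0 \<le> t \<Longrightarrow> (g has_integral (y t - a)) {0..t}"
  shows "continuous_on {0..} y"
  unfolding continuous_on_eq_continuous_within
proof
  fix t :: real assume t: "t \<in> {0..}"
  have cont: "continuous_on {0..t + 1} (\<lambda>x. a + integral {0..x} g)"
    by (intro continuous_intros indefinite_integral_continuous_1) (use int[of "t + 1"] t in auto)
  have "continuous_on {0..t + 1} y"
    by (rule continuous_on_eq[OF cont]) (simp add: integral_unique[OF int])
  then have "continuous (at t within {0..t + 1}) y"
    using t by (simp add: continuous_on_eq_continuous_within)
  then show "continuous (at t within {0..}) y"
    using t at_within_Icc_Ici[of t] by simp
qed

text \<open>For use where the integrand is continuous although the control is only measurable in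
  general: for the sum of the two states, and for \<open>S\<^sub>1\<close> under
  \<open>u = 1\<close>.\<close>

lemma DERIV_of_has_integral:
  fixes g y :: "real \<Rightarrow> real"
  assumes int: "\<And>t. 0 \<le> t \<Longrightarrow> (g has_integral (y t - a)) {0..t}"
    and cont: "continuous_on {0..} g" and "0 < t"
  shows "(y has_real_derivative g t) (at t)"
proof -
  have "((\<lambda>x. a + integral {0..x} g) has_real_derivative g t) (at t within {0..t + 1})"
    using integral_has_real_derivative[of 0 "t + 1" g t] \<open>0 < t\<close> continuous_on_subset[OF cont]
    by (auto intro!: derivative_eq_intros)
  then have "(y has_real_derivative g t) (at t within {0..t + 1})"
    by (rule has_field_derivative_transform_within[where d = 1])
      (use \<open>0 < t\<close> integral_unique[OF int] in auto)
  then show ?thesis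
    using at_within_Icc_at[of 0 t "t + 1"] \<open>0 < t\<close> by simp
qed

section \<open>Trajectories\<close>

lemma trajectory_state_domain: "trajectory f \<mu> M u x0 S \<Longrightarrow> 0 \<le> t \<Longrightarrow> S t \<in> state_domain M"
  by (simp add: trajectory_def)

lemma trajectory_nonneg:
  assumes "trajectory f \<mu> M u x0 S" "0 \<le> t"
  shows "0 \<le> fst (S t)" "0 \<le> snd (S t)" "fst (S t) + snd (S t) < M"
  using trajectory_state_domain[OF assms] by (auto simp: state_domain_def split: prod.splits)

lemma trajectory_continuous:
  assumes "trajectory f \<mu> M u x0 S"
  shows "continuous_on {0..} (\<lambda>t. fst (S t))" "continuous_on {0..} (\<lambda>t. snd (S t))"
  using assms unfolding trajectory_def by (blast intro: continuous_of_has_integral)+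

lemma trajectory_comp_continuous:
  assumes "trajectory f \<mu> M u x0 S" "continuous_on {0..} (g :: real \<Rightarrow> real)"
  shows "continuous_on {0..} (\<lambda>t. g (fst (S t)))" "continuous_on {0..} (\<lambda>t. g (snd (S t)))"
  using trajectory_nonneg[OF assms(1)]
  by (auto intro: continuous_on_compose2[OF assms(2) trajectory_continuous(1)[OF assms(1)]]
      continuous_on_compose2[OF assms(2) trajectory_continuous(2)[OF assms(1)]])

text \<open>The control cancels in the sum, so \<open>S\<^sub>1 + S\<^sub>2\<close> is differentiable for every measurable
  control.\<close>

lemma trajectory_sum_DERIV:
  assumes traj: "trajectory f \<mu> M u x0 S" and cont: "continuous_on {0..} \<mu>" and "0 < t"
  shows "((\<lambda>t. fst (S t) + snd (S t)) has_real_derivative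
           - \<mu> (snd (S t)) * (M - fst (S t) - snd (S t))) (at t)"
proof (rule DERIV_of_has_integral[where a = "fst x0 + snd x0", OF _ _ \<open>0 < t\<close>])
  fix t :: real assume "0 \<le> t"
  with traj have "((\<lambda>s. - u s * f (fst (S s))) has_integral (fst (S t) - fst x0)) {0..t}"
    and "((\<lambda>s. u s * f (fst (S s)) - \<mu> (snd (S s)) * (M - fst (S s) - snd (S s)))
              has_integral (snd (S t) - snd x0)) {0..t}"
    by (auto simp: trajectory_def)
  from has_integral_add[OF this]
  show "((\<lambda>s. - \<mu> (snd (S s)) * (M - fst (S s) - snd (S s))) has_integral
          (fst (S t) + snd (S t) - (fst x0 + snd x0))) {0..t}"
    by (simp add: algebra_simps)
next
  show "continuous_on {0..} (\<lambda>s. - \<mu> (snd (S s)) * (M - fst (S s) - snd (S s)))"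
    by (intro continuous_intros trajectory_continuous[OF traj] trajectory_comp_continuous[OF traj cont])
qed

section \<open>Comparison of the first state with maximal speed\<close>

lemma trajectory_fst_increment:
  assumes "trajectory f \<mu> M u x0 S" "0 \<le> s" "s \<le> t"
  shows "((\<lambda>r. - u r * f (fst (S r))) has_integral (fst (S t) - fst (S s))) {s..t}"
  by (rule has_integral_increment[of _ "\<lambda>t. fst (S t)"]) (use assms in \<open>auto simp: trajectory_def\<close>)

lemma trajectory_fst_antimono:
  assumes traj: "trajectory f \<mu> M u x0 S" and adm: "admissible_control u"
    and f: "\<And>x. 0 \<le> x \<Longrightarrow> 0 \<le> f x" and st: "0 \<le> s" "s \<le> t"
  shows "fst (S t) \<le> fst (S s)"
proof -
  have "fst (S t) - fst (S s) \<le> 0"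
    by (rule has_integral_le[OF trajectory_fst_increment[OF traj st] has_integral_0])
      (use st adm f trajectory_nonneg[OF traj] in \<open>auto simp: admissible_control_def mult_nonneg_nonneg\<close>)
  then show ?thesis by simp
qed

text \<open>Here \<open>u <= 1\<close> enters. The bound is an integral one because
  \<open>S\<^sub>1\<close> need not be differentiable everywhere, whereas the right-hand side is
  continuously differentiable in \<open>t\<close>.\<close>

lemma trajectory_fst_decrease_le:
  assumes traj: "trajectory f \<mu> M u x0 S" and adm: "admissible_control u"
    and f: "\<And>x. 0 \<le> x \<Longrightarrow> 0 \<le> f x" and cont: "continuous_on {0..} f" and st: "0 \<le> s" "s \<le> t"
  shows "fst (S s) - fst (S t) \<le> integral {s..t} (\<lambda>r. f (fst (S r)))"
proof -
  have "continuous_on {s..t} (\<lambda>r. f (fst (S r)))"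
    by (rule continuous_on_subset[OF trajectory_comp_continuous(1)[OF traj cont]]) (use st in auto)
  then have "((\<lambda>r. - f (fst (S r))) has_integral - integral {s..t} (\<lambda>r. f (fst (S r)))) {s..t}"
    by (intro has_integral_neg integrable_integral integrable_continuous_real)
  from has_integral_le[OF this trajectory_fst_increment[OF traj st]]
  have "- integral {s..t} (\<lambda>r. f (fst (S r))) \<le> fst (S t) - fst (S s)"
    using st adm f trajectory_nonneg[OF traj] by (auto simp: admissible_control_def mult_left_le_one_le)
  then show ?thesis by simp
qed

text \<open>Since \<open>f\<close> is increasing, a maximal-speed solution \<open>X\<close> that is strictly above \<open>S\<^sub>1\<close> descends
  faster; hence it cannot overtake \<open>S\<^sub>1\<close> from below.\<close>

lemma trajectory_fst_ge_maximal_speed: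
  assumes traj: "trajectory f \<mu> M u x0 S" and adm: "admissible_control u"
    and f: "\<And>x. 0 \<le> x \<Longrightarrow> 0 \<le> f x" and cont: "continuous_on {0..} f"
    and mono: "mono_on {0..} f"
    and contX: "continuous_on {0..} X"
    and derX: "\<And>t. 0 < t \<Longrightarrow> (X has_real_derivative - f (X t)) (at t)"
    and d: "0 \<le> d" "d \<le> a" "a \<le> b" and start: "X (a - d) \<le> fst (S a)"
  shows "X (b - d) \<le> fst (S b)"
proof (rule ccontr)
  assume neg: "\<not> X (b - d) \<le> fst (S b)"
  have contS: "continuous_on {0..} (\<lambda>t. fst (S t))" by (rule trajectory_continuous[OF traj])
  have contXd: "continuous_on {a..b} (\<lambda>t. X (t - d))"
    using d by (intro continuous_on_compose2[OF contX]) (auto intro: continuous_intros)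
  have "continuous_on {a..b} (\<lambda>t. fst (S t) - X (t - d))"
    using d contXd by (intro continuous_intros continuous_on_subset[OF contS]) auto
  \<comment> \<open>Restart at the last meeting time \<open>s\<close>; from there on the delayed
    \<open>X\<close> is strictly above \<open>S\<^sub>1\<close>.\<close>
  then obtain s where s: "a \<le> s" "s < b" "fst (S s) - X (s - d) = 0"
    and less: "\<And>t. s < t \<Longrightarrow> t \<le> b \<Longrightarrow> fst (S t) - X (t - d) < 0"
    by (rule last_zero_before_negative[OF \<open>a \<le> b\<close>]) (use neg start in auto)
  have contfS: "continuous_on {s..b} (\<lambda>r. f (fst (S r)))"
    by (rule continuous_on_subset[OF trajectory_comp_continuous(1)[OF traj cont]]) (use s d in auto)
  let ?\<Phi> = "\<lambda>t. integral {s..t} (\<lambda>r. f (fst (S r)))"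
  \<comment> \<open>\<open>?\<Phi>\<close> replaces the possibly nondifferentiable decrease of
    \<open>S\<^sub>1\<close>. As \<open>f\<close> is monotone, \<open>X\<close> loses at least
    \<open>?\<Phi> b\<close> on \<open>{s..b}\<close>, while \<open>S\<^sub>1\<close> loses at most
    that much; so \<open>X\<close> could not have ended above.\<close>
  have "X (s - d) + ?\<Phi> s \<ge> X (b - d) + ?\<Phi> b"
  proof (rule DERIV_nonpos_imp_decreasing_open[where f = "\<lambda>t. X (t - d) + ?\<Phi> t"])
    show "continuous_on {s..b} (\<lambda>t. X (t - d) + ?\<Phi> t)"
    proof (rule continuous_on_add)
      show "continuous_on {s..b} (\<lambda>t. X (t - d))"
        by (rule continuous_on_subset[OF contXd]) (use s in auto)
      show "continuous_on {s..b} ?\<Phi>"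
        by (rule indefinite_integral_continuous_1[OF integrable_continuous_real[OF contfS]])
    qed
    fix t assume t: "s < t" "t < b"
    have "(?\<Phi> has_real_derivative f (fst (S t))) (at t within {s..b})"
      by (rule integral_has_real_derivative[OF contfS]) (use t in auto)
    then have "(?\<Phi> has_real_derivative f (fst (S t))) (at t)"
      using t at_within_Icc_at[of s t b] by simp
    moreover have "((\<lambda>t. X (t - d)) has_real_derivative - f (X (t - d))) (at t)"
      using DERIV_shift[of X "- f (X (t - d))" t "- d"] derX[of "t - d"] t s d by simp
    moreover have "f (fst (S t)) \<le> f (X (t - d))"
      using less[of t] t s d trajectory_nonneg(1)[OF traj, of t]
      by (intro mono_onD[OF mono]) auto
    ultimately show "\<exists>y. ((\<lambda>t. X (t - d) + ?\<Phi> t) has_real_derivative y) (at t) \<and> y \<le> 0"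
      by (intro exI[of _ "- f (X (t - d)) + f (fst (S t))"] conjI DERIV_add) auto
  qed (use s in auto)
  moreover have "fst (S s) - fst (S b) \<le> ?\<Phi> b"
    using trajectory_fst_decrease_le[OF traj adm f cont, of s b] s d by linarith
  ultimately show False using s less[of b] by simp
qed

lemma maximal_control_admissible: "admissible_control (\<lambda>_. 1)"
  by (simp add: admissible_control_def)

lemma maximal_control_fst_DERIV:
  assumes traj: "trajectory f \<mu> M (\<lambda>_. 1) x0 S" and cont: "continuous_on {0..} f" and "0 < t"
  shows "((\<lambda>t. fst (S t)) has_real_derivative - f (fst (S t))) (at t)"
proof (rule DERIV_of_has_integral[where a = "fst x0", OF _ _ \<open>0 < t\<close>])
  show "continuous_on {0..} (\<lambda>s. - f (fst (S s)))"
    by (intro continuous_intros trajectory_continuous[OF traj] trajectory_comp_continuous[OF traj cont])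
qed (use traj in \<open>auto simp: trajectory_def\<close>)

text \<open>A negative value would force a zero between \<open>b1\<close> and that point,
  contradicting the minimality of \<open>c\<close>. This keeps \<open>\<mu>\<close> in the range
  where it is controlled.\<close>

lemma boundary_curve_nonneg:
  assumes bc: "boundary_curve f \<mu> M b1 b2 \<sigma> c" and "0 < b2" and s: "s \<in> {b1..c}"
  shows "0 \<le> \<sigma> s"
proof (rule ccontr)
  assume neg: "\<not> 0 \<le> \<sigma> s"
  have "continuous_on {b1..c} \<sigma>"
    using bc by (auto simp: boundary_curve_def intro: DERIV_continuous_on)
  then have "continuous_on {b1..s} \<sigma>"
    by (rule continuous_on_subset) (use s in auto)
  then obtain r where "b1 \<le> r" "r \<le> s" "\<sigma> r = 0"
    using IVT2'[of \<sigma> s 0 b1] neg bc s \<open>0 < b2\<close> by (auto simp: boundary_curve_def)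
  with bc neg s \<open>0 < b2\<close> show False
    by (auto simp: boundary_curve_def) (metis less_eq_real_def order.strict_trans2 less_irrefl)
qed

text \<open>Traversed at maximal speed, the boundary curve solves the same equation as \<open>S\<^sub>2\<close>, so the two
  cannot cross.\<close>

lemma maximal_speed_stays_below_curve:
  assumes bc: "boundary_curve f \<mu> M b1 b2 \<sigma> c" and "0 < b1" "0 < b2"
    and \<mu>: "C1_nonneg \<mu>" "\<mu> 0 = 0"
    and f: "\<And>x. 0 < x \<Longrightarrow> 0 < f x"
    and traj: "trajectory f \<mu> M u x0 S" and "0 \<le> T"
    and der: "\<And>t. 0 < t \<Longrightarrow> t < T \<Longrightarrow> ((\<lambda>t. fst (S t)) has_real_derivative - f (fst (S t))) (at t)"
    and rng: "\<And>t. 0 < t \<Longrightarrow> t < T \<Longrightarrow> b1 < fst (S t) \<and> fst (S t) < c"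
    and rng_cl: "\<And>t. 0 \<le> t \<Longrightarrow> t \<le> T \<Longrightarrow> b1 \<le> fst (S t) \<and> fst (S t) \<le> c"
    and start: "snd x0 \<le> \<sigma> (fst x0)"
  shows "snd (S T) \<le> \<sigma> (fst (S T))"
proof -
  have cont\<sigma>: "continuous_on {b1..c} \<sigma>"
    using bc by (auto simp: boundary_curve_def intro: DERIV_continuous_on)
  then have "bounded (\<sigma> ` {b1..c})" by (intro compact_imp_bounded compact_continuous_image) auto
  then obtain B0 where B0: "\<And>s. s \<in> {b1..c} \<Longrightarrow> \<bar>\<sigma> s\<bar> \<le> B0"
    unfolding bounded_iff by (metis imageI real_norm_def)
  \<comment> \<open>One interval \<open>{0..B}\<close> holds both \<open>S\<^sub>2\<close>, which is
    below \<open>M\<close>, and the values of the curve, so a single Lipschitz constant of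
    \<open>\<mu>\<close> serves for both.\<close>
  define B where "B = max M B0"
  obtain L where L: "0 \<le> L" "\<And>x y. x \<in> {0..B} \<Longrightarrow> y \<in> {0..B} \<Longrightarrow> \<bar>\<mu> x - \<mu> y\<bar> \<le> L * \<bar>x - y\<bar>"
    using C1_nonneg_lipschitz[OF \<mu>(1), of B] by blast
  \<comment> \<open>Gronwall for the gap: the terms \<open>f\<close> cancel in its derivative. In
    the constant, \<open>M + B\<close> bounds \<open>\<bar>M - x - q\<bar>\<close> and
    \<open>L * B\<close> bounds \<open>\<mu> z\<close>.\<close>
  have "0 \<le> \<sigma> (fst (S T)) - snd (S T)"
  proof (rule nonneg_of_linear_lower_bound[of T "\<lambda>t. \<sigma> (fst (S t)) - snd (S t)"
      "\<lambda>t. \<mu> (snd (S t)) * (M - fst (S t) - snd (S t))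
         - \<mu> (\<sigma> (fst (S t))) * (M - fst (S t) - \<sigma> (fst (S t)))" "L * (M + B) + L * B"])
    have cont: "continuous_on {0..T} (\<lambda>t. fst (S t))" "continuous_on {0..T} (\<lambda>t. snd (S t))"
      by (auto intro: continuous_on_subset[OF trajectory_continuous(1)[OF traj]]
          continuous_on_subset[OF trajectory_continuous(2)[OF traj]])
    show "continuous_on {0..T} (\<lambda>t. \<sigma> (fst (S t)) - snd (S t))"
      using rng_cl by (intro continuous_on_diff continuous_on_compose2[OF cont\<sigma>] cont) auto
    show "0 \<le> \<sigma> (fst (S 0)) - snd (S 0)" using traj start by (simp add: trajectory_def)
    fix t assume t: "0 < t" "t < T"
    define x q z where "x = fst (S t)" "q = \<sigma> x" "z = snd (S t)"
    note r = rng[OF t, folded x_q_z_def(1)]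
    have "(\<sigma> has_real_derivative \<mu> q * (M - x - q) / f x - 1) (at x within {b1..c})"
      using bc r by (auto simp: boundary_curve_def x_q_z_def(2))
    then have "(\<sigma> has_real_derivative \<mu> q * (M - x - q) / f x - 1) (at x)"
      using r at_within_Icc_at[of b1 x c] by simp
    \<comment> \<open>Passing from the variable \<open>x\<close> to time multiplies by
      \<open>- f x\<close>, which cancels the division by \<open>f x\<close> in the curve's
      equation.\<close>
    then have "((\<lambda>t. \<sigma> (fst (S t))) has_real_derivative (\<mu> q * (M - x - q) / f x - 1) * (- f x)) (at t)"
      unfolding x_q_z_def(1) by (rule DERIV_chain2[OF _ der[OF t]])
    moreover have "f x > 0" using f r \<open>0 < b1\<close> by auto
    ultimately have d\<sigma>: "((\<lambda>t. \<sigma> (fst (S t))) has_real_derivative f x - \<mu> q * (M - x - q)) (at t)"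
      by (simp add: left_diff_distrib)
    \<comment> \<open>The control \<open>u\<close> is arbitrary here, so the derivative of
      \<open>S\<^sub>2\<close> is recovered as that of the sum minus the assumed derivative of
      \<open>S\<^sub>1\<close>.\<close>
    have "((\<lambda>t. fst (S t) + snd (S t)) has_real_derivative - \<mu> z * (M - x - z)) (at t)"
      unfolding x_q_z_def by (intro trajectory_sum_DERIV[OF traj C1_nonneg_continuous[OF \<mu>(1)]] t)
    from DERIV_diff[OF this der[OF t, folded x_q_z_def(1)]]
    have "((\<lambda>t. snd (S t)) has_real_derivative f x - \<mu> z * (M - x - z)) (at t)" by simp
    from DERIV_diff[OF d\<sigma> this]
    show "((\<lambda>t. \<sigma> (fst (S t)) - snd (S t)) has_real_derivative
      \<mu> (snd (S t)) * (M - fst (S t) - snd (S t))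
         - \<mu> (\<sigma> (fst (S t))) * (M - fst (S t) - \<sigma> (fst (S t)))) (at t)"
      by (simp add: x_q_z_def)
    have z: "z \<in> {0..B}" "x \<in> {0..M}"
      using trajectory_nonneg[OF traj, of t] t by (auto simp: x_q_z_def B_def)
    have q: "q \<in> {0..B}"
      using boundary_curve_nonneg[OF bc \<open>0 < b2\<close>, of x] B0[of x] r by (auto simp: x_q_z_def(2) B_def)
    have "\<bar>\<mu> z\<bar> \<le> L * B" 
      using L(2)[of z 0] z mult_left_mono[of z B L] L(1) \<mu>(2) by auto
    then have "\<bar>\<mu> z - \<mu> q\<bar> * \<bar>M - x - q\<bar> + \<bar>\<mu> z\<bar> * \<bar>q - z\<bar> \<le> (L * \<bar>z - q\<bar>) * (M + B) + (L * B) * \<bar>q - z\<bar>"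
      using L z q by (intro add_mono mult_mono) auto
    moreover have "\<bar>\<mu> z * (M - x - z) - \<mu> q * (M - x - q)\<bar>
        = \<bar>(\<mu> z - \<mu> q) * (M - x - q) + \<mu> z * (q - z)\<bar>" by (simp add: algebra_simps)
    moreover have "\<dots> \<le> \<bar>\<mu> z - \<mu> q\<bar> * \<bar>M - x - q\<bar> + \<bar>\<mu> z\<bar> * \<bar>q - z\<bar>"
      by (metis abs_mult abs_triangle_ineq)
    ultimately have "\<bar>\<mu> z * (M - x - z) - \<mu> q * (M - x - q)\<bar> \<le> (L * (M + B) + L * B) * \<bar>q - z\<bar>"
      by (simp add: algebra_simps abs_minus_commute)
    then show "- (L * (M + B) + L * B) * \<bar>\<sigma> (fst (S t)) - snd (S t)\<bar>
      \<le> \<mu> (snd (S t)) * (M - fst (S t) - snd (S t))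
         - \<mu> (\<sigma> (fst (S t))) * (M - fst (S t) - \<sigma> (fst (S t)))"
      unfolding x_q_z_def[symmetric] by linarith
  qed fact
  then show ?thesis by simp
qed

section \<open>Existence for the maximal control\<close>

text \<open>Clipping the arguments of the right-hand side to \<open>[0, M]\<close> makes it globally Lipschitz and does
  not affect solutions, which never leave the state domain.\<close>

definition clip :: "real \<Rightarrow> real \<Rightarrow> real" where
  "clip M x = min M (max 0 x)"

lemma clip_mem: "0 \<le> M \<Longrightarrow> clip M x \<in> {0..M}"
  and clip_eq: "x \<in> {0..M} \<Longrightarrow> clip M x = x"
  and clip_le_abs: "0 \<le> M \<Longrightarrow> clip M x \<le> \<bar>x\<bar>"
  and clip_lipschitz: "0 \<le> M \<Longrightarrow> \<bar>clip M x - clip M y\<bar> \<le> \<bar>x - y\<bar>"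
  by (auto simp: clip_def min_def max_def)

lemma maximal_control_trajectory_exists:
  assumes f: "C1_nonneg f" "f 0 = 0" and \<mu>: "C1_nonneg \<mu>" "\<mu> 0 = 0"
    and x0: "x0 \<in> state_domain M" "0 < fst x0"
  obtains S where "trajectory f \<mu> M (\<lambda>_. 1) x0 S"
proof -
  have M: "0 \<le> M" using x0 by (auto simp: state_domain_def)
  obtain Lf where Lf: "0 \<le> Lf" "\<And>x y. x \<in> {0..M} \<Longrightarrow> y \<in> {0..M} \<Longrightarrow> \<bar>f x - f y\<bar> \<le> Lf * \<bar>x - y\<bar>"
    using C1_nonneg_lipschitz[OF f(1), of M] by blast
  obtain Lm where Lm: "0 \<le> Lm" "\<And>x y. x \<in> {0..M} \<Longrightarrow> y \<in> {0..M} \<Longrightarrow> \<bar>\<mu> x - \<mu> y\<bar> \<le> Lm * \<bar>x - y\<bar>"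
    using C1_nonneg_lipschitz[OF \<mu>(1), of M] by blast
  have f_nonneg: "0 \<le> f (clip M x)" and \<mu>_nonneg: "0 \<le> \<mu> (clip M x)" for x
    using f(1) \<mu>(1) clip_mem[OF M] by (auto simp: C1_nonneg_def)
  have f_le: "f (clip M x) \<le> Lf * \<bar>x\<bar>" for x
  proof -
    have "f (clip M x) \<le> Lf * clip M x"
      using Lf(2)[of "clip M x" 0] clip_mem[OF M, of x] M f(2) by auto
    also have "\<dots> \<le> Lf * \<bar>x\<bar>" by (intro mult_left_mono clip_le_abs M Lf)
    finally show ?thesis .
  qed
  have \<mu>_le: "\<mu> (clip M x) \<le> Lm * clip M x" for x
    using Lm(2)[of "clip M x" 0] clip_mem[OF M, of x] M \<mu>(2) by auto
  have f_lip: "\<bar>f (clip M x) - f (clip M y)\<bar> \<le> Lf * \<bar>x - y\<bar>" for x y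
    by (rule order_trans[OF Lf(2)[OF clip_mem[OF M] clip_mem[OF M]]])
      (intro mult_left_mono clip_lipschitz M Lf)
  have \<mu>_lip: "\<bar>\<mu> (clip M x) - \<mu> (clip M y)\<bar> \<le> Lm * \<bar>x - y\<bar>" for x y
    by (rule order_trans[OF Lm(2)[OF clip_mem[OF M] clip_mem[OF M]]])
      (intro mult_left_mono clip_lipschitz M Lm)
  have \<mu>_bound: "\<mu> (clip M x) \<le> Lm * M" for x
    using \<mu>_le[of x] mult_left_mono[of "clip M x" M Lm] clip_mem[OF M, of x] Lm(1) by auto
  \<comment> \<open>The factor \<open>M - p - q\<close> is clipped as well: this makes
    \<open>h\<close> nonnegative and bounded, and its product structure gives the Lipschitz
    bound.\<close>
  define h where "h p q = \<mu> (clip M q) * clip M (M - p - q)" for p q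
  have h_nonneg: "0 \<le> h p q" for p q
    using \<mu>_nonneg clip_mem[OF M] by (auto simp: h_def)
  have h_lip: "\<bar>h p q - h p' q'\<bar> \<le> (Lm * M) * (\<bar>p - p'\<bar> + 2 * \<bar>q - q'\<bar>)" for p q p' q'
  proof -
    let ?c = "clip M (M - p - q)" and ?c' = "clip M (M - p' - q')"
    have "h p q - h p' q' = (\<mu> (clip M q) - \<mu> (clip M q')) * ?c + \<mu> (clip M q') * (?c - ?c')"
      by (simp add: h_def algebra_simps)
    then have "\<bar>h p q - h p' q'\<bar>
        \<le> \<bar>\<mu> (clip M q) - \<mu> (clip M q')\<bar> * \<bar>?c\<bar> + \<bar>\<mu> (clip M q')\<bar> * \<bar>?c - ?c'\<bar>"
      by (metis abs_mult abs_triangle_ineq)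
    also have "\<dots> \<le> (Lm * \<bar>q - q'\<bar>) * M + (Lm * M) * (\<bar>p - p'\<bar> + \<bar>q - q'\<bar>)"
    proof (intro add_mono mult_mono \<mu>_lip)
      show "\<bar>?c - ?c'\<bar> \<le> \<bar>p - p'\<bar> + \<bar>q - q'\<bar>"
        using clip_lipschitz[OF M, of "M - p - q" "M - p' - q'"] by linarith
    qed (use clip_mem[OF M, of "M - p - q"] \<mu>_bound \<mu>_nonneg Lm(1) M in auto)
    finally show ?thesis by (simp add: algebra_simps)
  qed
  define F :: "real \<times> real \<Rightarrow> real \<times> real" where
    "F v = (- f (clip M (fst v)), f (clip M (fst v)) - h (fst v) (snd v))" for v
  have F_lip: "(2 * Lf + 3 * (Lm * M))-lipschitz_on UNIV F"
  proof (rule lipschitz_onI)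
    fix v w :: "real \<times> real"
    have d: "\<bar>fst v - fst w\<bar> \<le> dist v w" "\<bar>snd v - snd w\<bar> \<le> dist v w"
      using dist_fst_le[of v w] dist_snd_le[of v w] by (auto simp: dist_real_def)
    have "Lf * \<bar>fst v - fst w\<bar> \<le> Lf * dist v w"
      by (intro mult_left_mono d Lf)
    moreover have "(Lm * M) * (\<bar>fst v - fst w\<bar> + 2 * \<bar>snd v - snd w\<bar>) \<le> (Lm * M) * (3 * dist v w)"
      using d Lm(1) M by (intro mult_left_mono) auto
    moreover have "dist (F v) (F w) \<le> \<bar>fst (F v) - fst (F w)\<bar> + \<bar>snd (F v) - snd (F w)\<bar>"
      using norm_Pair_le[of "fst (F v) - fst (F w)" "snd (F v) - snd (F w)"]
      by (simp add: dist_norm flip: minus_prod_def)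
    moreover have "\<bar>fst (F v) - fst (F w)\<bar> \<le> Lf * \<bar>fst v - fst w\<bar>"
      and "\<bar>snd (F v) - snd (F w)\<bar>
        \<le> Lf * \<bar>fst v - fst w\<bar> + (Lm * M) * (\<bar>fst v - fst w\<bar> + 2 * \<bar>snd v - snd w\<bar>)"
      using f_lip[of "fst v" "fst w"] h_lip[of "fst v" "snd v" "fst w" "snd w"]
      by (auto simp: F_def)
    ultimately show "dist (F v) (F w) \<le> (2 * Lf + 3 * (Lm * M)) * dist v w"
      unfolding distrib_right[of "2 * Lf"] by linarith
  qed (use Lf Lm M in auto)
  obtain y where y0: "y 0 = x0"
    and y: "\<And>t. 0 \<le> t \<Longrightarrow> (y has_vector_derivative F (y t)) (at t within {0..})"
    using lipschitz_ode_global_solution[OF F_lip] by blast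
  define p q where "p t = fst (y t)" and "q t = snd (y t)" for t
  have "(p has_vector_derivative fst (F (y t))) (at t within {0..})"
       "(q has_vector_derivative snd (F (y t))) (at t within {0..})" if "0 \<le> t" for t
    unfolding p_def q_def
    by (auto intro!: y that bounded_linear.has_vector_derivative[OF bounded_linear_fst]
        bounded_linear.has_vector_derivative[OF bounded_linear_snd])
  then have dp: "(p has_real_derivative - f (clip M (p t))) (at t within {0..})"
    and dq: "(q has_real_derivative f (clip M (p t)) - h (p t) (q t)) (at t within {0..})" if "0 \<le> t" for t
    using that by (auto simp: F_def p_def q_def has_real_derivative_iff_has_vector_derivative)
  have at: "at t within {0..} = at t" if "0 < t" for t :: real
    using that by (intro at_within_interior) simp
  have contp: "continuous_on {0..T} p" and contq: "continuous_on {0..T} q" for T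
    by (auto intro!: DERIV_continuous_on DERIV_subset[OF dp] DERIV_subset[OF dq])
  \<comment> \<open>Since \<open>f 0 = 0\<close>, the speed of \<open>p\<close> is at most linear in
    \<open>p\<close>, so 0 is not reached in finite time.\<close>
  have p_pos: "0 < p t" if "0 \<le> t" for t
  proof (rule pos_of_linear_lower_bound[of t p "\<lambda>t. - f (clip M (p t))" Lf])
    show "0 < p 0" using x0 by (simp add: p_def y0)
    fix s assume s: "0 < s" "s < t"
    show "(p has_real_derivative - f (clip M (p s))) (at s)"
      using dp[of s] at[OF s(1)] s by simp
    show "- Lf * \<bar>p s\<bar> \<le> - f (clip M (p s))" using f_le[of "p s"] by simp
  qed (use that contp in auto)
  \<comment> \<open>The gap \<open>M - p - q\<close> grows at rate \<open>h >= 0\<close>, so the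
    constant 0 suffices in the comparison.\<close>
  have v_pos: "0 < M - p t - q t" if "0 \<le> t" for t
  proof (rule pos_of_linear_lower_bound[of t "\<lambda>t. M - p t - q t" "\<lambda>t. h (p t) (q t)" 0])
    show "0 < M - p 0 - q 0" using x0 by (auto simp: p_def q_def y0 state_domain_def)
    fix s assume s: "0 < s" "s < t"
    show "((\<lambda>t. M - p t - q t) has_real_derivative h (p s) (q s)) (at s)"
      using dp[of s] dq[of s] at[OF s(1)] s by (auto intro!: derivative_eq_intros)
  qed (use that h_nonneg in \<open>auto intro!: continuous_intros contp contq\<close>)
  \<comment> \<open>Near \<open>q = 0\<close> the loss term is at most linear in
    \<open>\<bar>q\<bar>\<close> because \<open>\<mu> 0 = 0\<close>, and the gain term is
    nonnegative.\<close>
  have q_nonneg: "0 \<le> q t" if "0 \<le> t" for t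
  proof (rule nonneg_of_linear_lower_bound[of t q "\<lambda>t. f (clip M (p t)) - h (p t) (q t)" "Lm * M"])
    show "0 \<le> q 0" using x0 by (auto simp: q_def y0 state_domain_def)
    fix s assume s: "0 < s" "s < t"
    show "(q has_real_derivative f (clip M (p s)) - h (p s) (q s)) (at s)"
      using dq[of s] at[OF s(1)] s by simp
    have "h (p s) (q s) \<le> (Lm * \<bar>q s\<bar>) * M"
      unfolding h_def
    proof (rule mult_mono)
      show "\<mu> (clip M (q s)) \<le> Lm * \<bar>q s\<bar>"
        by (rule order_trans[OF \<mu>_le]) (intro mult_left_mono clip_le_abs M Lm)
    qed (use clip_mem[OF M, of "M - p s - q s"] Lm in auto)
    then show "- (Lm * M) * \<bar>q s\<bar> \<le> f (clip M (p s)) - h (p s) (q s)"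
      using f_nonneg[of "p s"] by (simp add: algebra_simps)
  qed (use that contq in auto)
  have clips: "clip M (p t) = p t" "h (p t) (q t) = \<mu> (q t) * (M - p t - q t)" if "0 \<le> t" for t
    using p_pos[OF that] q_nonneg[OF that] v_pos[OF that] by (auto simp: h_def clip_eq)
  have "trajectory f \<mu> M (\<lambda>_. 1) x0 y"
    unfolding trajectory_def
  proof (intro conjI allI impI)
    fix t :: real assume t: "0 \<le> t"
    show "y t \<in> state_domain M"
      using p_pos[OF t] q_nonneg[OF t] v_pos[OF t]
      unfolding state_domain_def p_def q_def case_prod_unfold by simp
    have "((\<lambda>s. - f (clip M (p s))) has_integral p t - p 0) {0..t}"
      using t by (intro fundamental_theorem_of_calculus)
        (auto simp flip: has_real_derivative_iff_has_vector_derivative intro!: DERIV_subset[OF dp])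
    then have "((\<lambda>s. - f (p s)) has_integral p t - p 0) {0..t}"
      by (rule has_integral_eq[rotated]) (simp add: clips)
    then show "((\<lambda>s. - 1 * f (fst (y s))) has_integral fst (y t) - fst x0) {0..t}"
      by (simp add: p_def y0)
    have "((\<lambda>s. f (clip M (p s)) - h (p s) (q s)) has_integral q t - q 0) {0..t}"
      using t by (intro fundamental_theorem_of_calculus)
        (auto simp flip: has_real_derivative_iff_has_vector_derivative intro!: DERIV_subset[OF dq])
    then have "((\<lambda>s. f (p s) - \<mu> (q s) * (M - p s - q s)) has_integral q t - q 0) {0..t}"
      by (rule has_integral_eq[rotated]) (simp add: clips)
    then show "((\<lambda>s. 1 * f (fst (y s)) - \<mu> (snd (y s)) * (M - fst (y s) - snd (y s)))
        has_integral snd (y t) - snd x0) {0..t}"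
      by (simp add: p_def q_def y0)
  qed (rule y0)
  with that show ?thesis .
qed

section \<open>Time optimality\<close>

text \<open>As long as \<open>S\<^sub>1 >= b\<close>, it falls at rate at least
  \<open>f b > 0\<close>. This bounds the time needed to reach \<open>b\<close> and makes the
  descent strict.\<close>

lemma maximal_control_hitting_time:
  assumes traj: "trajectory f \<mu> M (\<lambda>_. 1) x0 S" and cont: "continuous_on {0..} f"
    and mono: "strict_mono_on {0..} f" and f0: "f 0 = 0"
    and b: "0 < b" "b < fst x0"
  obtains T where "0 < T" "fst (S T) = b" "\<And>t. 0 \<le> t \<Longrightarrow> t < T \<Longrightarrow> b < fst (S t)"
    "\<And>s t. 0 \<le> s \<Longrightarrow> s < t \<Longrightarrow> t \<le> T \<Longrightarrow> fst (S t) < fst (S s)"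
proof -
  have f_pos: "0 < f x" if "0 < x" for x
    using strict_mono_onD[OF mono, of 0 x] that f0 by simp
  have f_nonneg: "0 \<le> f x" if "0 \<le> x" for x
    using f_pos[of x] f0 that by (cases "x = 0") auto
  have anti: "fst (S t) \<le> fst (S s)" if "0 \<le> s" "s \<le> t" for s t
    by (rule trajectory_fst_antimono[OF traj maximal_control_admissible f_nonneg that])
  have S0: "fst (S 0) = fst x0" using traj by (simp add: trajectory_def)
  have drop: "fst (S t) \<le> fst (S s) - f b * (t - s)" if st: "0 \<le> s" "s \<le> t" "b \<le> fst (S t)" for s t
  proof -
    have "fst (S t) - fst (S s) \<le> (t - s) *\<^sub>R - f b"
    proof (rule has_integral_le[OF trajectory_fst_increment[OF traj st(1,2)]])
      show "((\<lambda>_. - f b) has_integral (t - s) *\<^sub>R - f b) {s..t}"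
        using has_integral_const_real[of "- f b" s t] st by simp
      fix r assume "r \<in> {s..t}"
      then have "b \<le> fst (S r)" using anti[of r t] st by auto
      then show "- 1 * f (fst (S r)) \<le> - f b"
        using strict_mono_onD[OF mono, of b "fst (S r)"] b by (cases "b = fst (S r)") auto
    qed
    then show ?thesis by (simp add: algebra_simps)
  qed
  have "\<exists>t\<ge>0. fst (S t) \<le> b"
  proof (rule ccontr)
    assume "\<not> ?thesis"
    then have above: "b < fst (S t)" if "0 \<le> t" for t using that by force
    \<comment> \<open>By this time a descent at rate \<open>f b\<close> from \<open>fst x0\<close>
      would have arrived at 0, which is below \<open>b\<close>.\<close>
    define t where "t = fst x0 / f b"
    have "0 \<le> t" using b f_pos[of b] by (simp add: t_def)
    with drop[of 0 t] above[of t] S0 f_pos[of b] b show False by (simp add: t_def)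
  qed
  then obtain t1 where "0 \<le> t1" "fst (S t1) \<le> b" by blast
  moreover have "continuous_on {0..t1} (\<lambda>t. fst (S t))"
    by (rule continuous_on_subset[OF trajectory_continuous(1)[OF traj]]) auto
  ultimately obtain T where T: "0 \<le> T" "fst (S T) = b"
    using IVT2'[of "\<lambda>t. fst (S t)" t1 b 0] b S0 by auto
  have dec: "fst (S t) < fst (S s)" if "0 \<le> s" "s < t" "t \<le> T" for s t
  proof -
    have "0 < f b * (t - s)" using that f_pos[OF b(1)] by simp
    then show ?thesis using drop[of s t] anti[of t T] that T by simp
  qed
  show ?thesis
  proof (rule that)
    show "0 < T" using T b S0 by (cases "T = 0") auto
  qed (use dec T in auto)
qed

text \<open>If \<open>S\<^sub>1\<close> were above \<open>X\<close> at time \<open>t\<close>, it would have the value of \<open>X\<close> at an earlier time \<open>r\<close>, so it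
  would stay above the solution delayed by \<open>t - r\<close> and be late at time \<open>T\<close>.\<close>

lemma trajectory_fst_determined:
  fixes X :: "real \<Rightarrow> real"
  assumes traj: "trajectory f \<mu> M u x0 S" and adm: "admissible_control u"
    and f: "\<And>x. 0 \<le> x \<Longrightarrow> 0 \<le> f x" and cont: "continuous_on {0..} f" and mono: "mono_on {0..} f"
    and contX: "continuous_on {0..} X"
    and derX: "\<And>t. 0 < t \<Longrightarrow> (X has_real_derivative - f (X t)) (at t)"
    and X0: "X 0 = fst x0"
    and decX: "\<And>s t. 0 \<le> s \<Longrightarrow> s < t \<Longrightarrow> t \<le> T \<Longrightarrow> X t < X s"
    and final: "fst (S T) \<le> X T"
    and t: "0 \<le> t" "t \<le> T"
  shows "fst (S t) = X t"
proof (rule antisym)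
  have S0: "fst (S 0) = fst x0" using traj by (simp add: trajectory_def)
  show "X t \<le> fst (S t)"
    using trajectory_fst_ge_maximal_speed[OF traj adm f cont mono contX derX, of 0 0 t] t X0 S0 by simp
  show "fst (S t) \<le> X t"
  proof (rule ccontr)
    assume "\<not> fst (S t) \<le> X t"
    moreover have "fst (S t) \<le> X 0"
      using trajectory_fst_antimono[OF traj adm f, of 0 t] t X0 S0 by simp
    moreover have "continuous_on {0..t} X" by (rule continuous_on_subset[OF contX]) auto
    ultimately obtain r where r: "0 \<le> r" "r \<le> t" "X r = fst (S t)"
      using IVT2'[of X t "fst (S t)" 0] t by force
    then have "r < t" using \<open>\<not> fst (S t) \<le> X t\<close> by (cases "r = t") auto
    \<comment> \<open>The delay \<open>t - r\<close> makes the comparison start with equality at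
      time \<open>t\<close>, as \<open>X r = fst (S t)\<close>.\<close>
    have "X (T - (t - r)) \<le> fst (S T)"
      by (rule trajectory_fst_ge_maximal_speed[OF traj adm f cont mono contX derX, of "t - r" t T])
        (use r t in auto)
    moreover have "X T < X (T - (t - r))" using decX[of "T - (t - r)" T] r t \<open>r < t\<close> by simp
    ultimately show False using final by simp
  qed
qed

theorem proposition2:
  fixes f \<mu> \<sigma>\<^sub>2 :: "real \<Rightarrow> real" and M b1 b2 c :: real and x0 :: "real \<times> real"
  assumes "0 < M" and "0 < b1" and "0 < b2" and "b1 + b2 < M"
    and "C1_nonneg f" and "C1_nonneg \<mu>"
    and "H0 f" and "H1 \<mu>"
    and "boundary_curve f \<mu> M b1 b2 \<sigma>\<^sub>2 c"
    and "x0 \<in> Z1 M b1 b2 \<sigma>\<^sub>2 c"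
  shows "(\<forall>u S tf. optimal_trajectory f \<mu> M b1 b2 x0 u S tf
            \<longrightarrow> (\<forall>t. 0 \<le> t \<and> t < tf \<longrightarrow> S t \<in> Z1 M b1 b2 \<sigma>\<^sub>2 c)) \<and>
         optimal_control f \<mu> M b1 b2 x0 (\<lambda>_. 1)"
proof -
  have mono: "strict_mono_on {0..} f" and f0: "f 0 = 0" and \<mu>0: "\<mu> 0 = 0"
    using \<open>H0 f\<close> \<open>H1 \<mu>\<close> by (auto simp: H0_def H1_def)
  have mono': "mono_on {0..} f" using mono by (rule strict_mono_on_imp_mono_on)
  have contf: "continuous_on {0..} f" using \<open>C1_nonneg f\<close> by (rule C1_nonneg_continuous)
  have f_nonneg: "0 \<le> f x" if "0 \<le> x" for x using \<open>C1_nonneg f\<close> that by (simp add: C1_nonneg_def)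
  have f_pos: "0 < f x" if "0 < x" for x
    using strict_mono_onD[OF mono, of 0 x] that f0 by simp
  have x0: "x0 \<in> state_domain M" "b1 < fst x0" "fst x0 \<le> c" "snd x0 \<le> \<sigma>\<^sub>2 (fst x0)"
    using \<open>x0 \<in> Z1 M b1 b2 \<sigma>\<^sub>2 c\<close> by (auto simp: Z1_def)
  note hitting = maximal_control_hitting_time[OF _ contf mono f0 \<open>0 < b1\<close> x0(2)]
  \<comment> \<open>Stated for any trajectory sharing its first component with a maximal-speed one,
    so that it covers both \<open>u = 1\<close> itself and an arbitrary optimal control.\<close>
  have below: "snd (S t) \<le> \<sigma>\<^sub>2 (fst (S t))"
    if traj: "trajectory f \<mu> M u x0 S" and X: "trajectory f \<mu> M (\<lambda>_. 1) x0 X"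
      and T: "fst (X T) = b1" "\<And>s t. 0 \<le> s \<Longrightarrow> s < t \<Longrightarrow> t \<le> T \<Longrightarrow> fst (X t) < fst (X s)"
      and eq: "\<And>t. 0 \<le> t \<Longrightarrow> t \<le> T \<Longrightarrow> fst (S t) = fst (X t)" and t: "0 \<le> t" "t \<le> T"
    for u S X T t
  proof (rule maximal_speed_stays_below_curve[OF \<open>boundary_curve f \<mu> M b1 b2 \<sigma>\<^sub>2 c\<close>
        \<open>0 < b1\<close> \<open>0 < b2\<close> \<open>C1_nonneg \<mu>\<close> \<mu>0 f_pos traj t(1)])
    fix r assume r: "0 < r" "r < t"
    have "((\<lambda>t. fst (X t)) has_real_derivative - f (fst (X r))) (at r)"
      by (rule maximal_control_fst_DERIV[OF X contf r(1)])
    then show "((\<lambda>t. fst (S t)) has_real_derivative - f (fst (S r))) (at r)"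
      unfolding eq[OF less_imp_le[OF r(1)] less_imp_le[OF less_le_trans[OF r(2) t(2)]]]
      \<comment> \<open>The first components are known to agree up to \<open>T\<close> only, hence
        the transfer on an open interval around \<open>r\<close>.\<close>
      by (rule has_field_derivative_transform_within_open[where S = "{0<..<T}"]) (use r t eq in auto)
    show "b1 < fst (S r) \<and> fst (S r) < c"
      using T(2)[of r T] T(2)[of 0 r] r t T(1) eq[of r] x0(3) X by (auto simp: trajectory_def)
  next
    fix r assume r: "0 \<le> r" "r \<le> t"
    have "fst (X r) \<le> fst (X 0)" using T(2)[of 0 r] r t by (cases "r = 0") auto
    moreover have "fst (X T) \<le> fst (X r)" using T(2)[of r T] r t by (cases "r = T") auto
    ultimately show "b1 \<le> fst (S r) \<and> fst (S r) \<le> c"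
      using T(1) eq[of r] r t x0(3) X by (auto simp: trajectory_def)
  qed (use x0 in auto)
  have fst_ge: "fst (X t) \<le> fst (S t)"
    if X: "trajectory f \<mu> M (\<lambda>_. 1) x0 X" and S: "trajectory f \<mu> M u x0 S" "admissible_control u" "0 \<le> t"
    for X u S t
    using trajectory_fst_ge_maximal_speed[OF S(1,2) f_nonneg contf mono'
        trajectory_continuous(1)[OF X] maximal_control_fst_DERIV[OF X contf], of 0 0 t] X S
    by (simp add: trajectory_def)
  have maximal_optimal: "optimal_trajectory f \<mu> M b1 b2 x0 (\<lambda>_. 1) X T"
    if X: "trajectory f \<mu> M (\<lambda>_. 1) x0 X" and T: "0 < T" "fst (X T) = b1"
      "\<And>t. 0 \<le> t \<Longrightarrow> t < T \<Longrightarrow> b1 < fst (X t)"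
      "\<And>s t. 0 \<le> s \<Longrightarrow> s < t \<Longrightarrow> t \<le> T \<Longrightarrow> fst (X t) < fst (X s)" for X T
    unfolding optimal_trajectory_def
  proof (intro conjI allI impI)
    \<comment> \<open>At time \<open>T\<close> the curve is at the corner of the target, so being
      below it means \<open>S\<^sub>2 <= b2\<close>.\<close>
    have "\<sigma>\<^sub>2 b1 = b2" using assms(9) by (simp add: boundary_curve_def)
    then show "X T \<in> target b1 b2"
      using below[OF X X T(2,4), of T] T(1,2) trajectory_nonneg[OF X, of T] \<open>0 < b1\<close>
      by (auto simp: target_def mem_Times_iff)
    fix v R t
    assume R: "admissible_control v \<and> trajectory f \<mu> M v x0 R \<and> 0 \<le> t \<and> R t \<in> target b1 b2"
    then have "fst (R t) \<le> b1" by (auto simp: target_def)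
    \<comment> \<open>Before \<open>T\<close> the maximal-speed solution is still above
      \<open>b1\<close>, and every competitor is at least as high.\<close>
    with R fst_ge[OF X, of v R t] T(3)[of t] show "T \<le> t" by force
  qed (use X T maximal_control_admissible in auto)
  obtain X where X: "trajectory f \<mu> M (\<lambda>_. 1) x0 X"
    using maximal_control_trajectory_exists[OF \<open>C1_nonneg f\<close> f0 \<open>C1_nonneg \<mu>\<close> \<mu>0 x0(1)] x0(2) \<open>0 < b1\<close>
    by (meson order_less_trans)
  have stays: "S t \<in> Z1 M b1 b2 \<sigma>\<^sub>2 c"
    if opt: "optimal_trajectory f \<mu> M b1 b2 x0 u S tf" and t: "0 \<le> t" "t < tf" for u S tf t
  proof -
    obtain T where T: "0 < T" "fst (X T) = b1" "\<And>t. 0 \<le> t \<Longrightarrow> t < T \<Longrightarrow> b1 < fst (X t)"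
      "\<And>s t. 0 \<le> s \<Longrightarrow> s < t \<Longrightarrow> t \<le> T \<Longrightarrow> fst (X t) < fst (X s)"
      using hitting[OF X] by blast
    have S: "trajectory f \<mu> M u x0 S" "admissible_control u" "fst (S tf) \<le> b1"
      using opt by (auto simp: optimal_trajectory_def target_def)
    have "optimal_trajectory f \<mu> M b1 b2 x0 (\<lambda>_. 1) X T"
      by (rule maximal_optimal[OF X T])
    \<comment> \<open>Both times are minimal among the same competitors. Hence the given control is
      exactly as fast as \<open>u = 1\<close>, which fixes its first component.\<close>
    with opt have "tf = T"
      unfolding optimal_trajectory_def by (meson order_antisym)
    have eq: "fst (S r) = fst (X r)" if "0 \<le> r" "r \<le> T" for r
      by (rule trajectory_fst_determined[OF S(1,2) f_nonneg contf mono'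
          trajectory_continuous(1)[OF X] maximal_control_fst_DERIV[OF X contf] _ T(4) _ that])
        (use X S(3) T(2) \<open>tf = T\<close> in \<open>auto simp: trajectory_def\<close>)
    have "fst (X t) \<le> fst (X 0)" using T(4)[of 0 t] t \<open>tf = T\<close> by (cases "t = 0") auto
    then have "b1 < fst (S t)" "fst (S t) \<le> c"
      using T(3)[of t] eq[of t] t \<open>tf = T\<close> x0(3) X by (auto simp: trajectory_def)
    moreover have "snd (S t) \<le> \<sigma>\<^sub>2 (fst (S t))"
      by (rule below[OF S(1) X T(2,4) eq]) (use t \<open>tf = T\<close> in auto)
    ultimately show ?thesis
      using trajectory_state_domain[OF S(1) t(1)]
      unfolding Z1_def target_def case_prod_unfold by (simp add: mem_Times_iff)
  qed
  have "optimal_control f \<mu> M b1 b2 x0 (\<lambda>_. 1)"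
    unfolding optimal_control_def
  proof (intro conjI allI impI exI[of _ X] X)
    fix S assume S: "trajectory f \<mu> M (\<lambda>_. 1) x0 S"
    show "\<exists>tf. optimal_trajectory f \<mu> M b1 b2 x0 (\<lambda>_. 1) S tf"
      by (rule hitting[OF S]) (rule exI, rule maximal_optimal[OF S])
  qed
  with stays show ?thesis by blast
qed

end
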